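(* Let $\alpha,\beta>0$, $A\in\mathbb{R}^{n\times p}$, and let $k$ be a positive integer. Suppose that $$(1+\beta\alpha)\|h_{\mathcal{S}}\|_1\le\|h_{\bar{\mathcal{S}}}\|_1$$ holds for all vectors $h\in\mathbb{R}^p$ with $Ah=0$ and all coordinate sets $\mathcal{S}\subset\{1,\dots,p\}$ of cardinality $|\mathcal{S}|\le k$. Then for every $k$-sparse vector $x_0\in\mathbb{R}^p$, with $y=Ax_0$, the vector $x_0$ is the unique solution of $$\min_{x\in\mathbb{R}^p}\{\|x\|_1+\beta\Phi(x):Ax=y\}.$$
   Context: $\Phi(x)=\sum_{i=1}^p\varphi(x_i)$ with $\varphi(t)=\frac{\alpha|t|}{1+\alpha|t|}$. A vector is $k$-sparse if it has at most $k$ nonzero entries. For $\mathcal{S}\subset\{1,\dots,p\}$, $\bar{\mathcal{S}}$ is its complement and $h_{\mathcal{S}}$ denotes the vector that agrees with $h$ on $\mathcal{S}$ and is zero elsewhere. *)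

theory Defs
  imports "HOL-Analysis.Analysis"
begin

definition l1_norm :: "real ^ 'p \<Rightarrow> real" where
  "l1_norm x = (\<Sum>i\<in>UNIV. \<bar>x $ i\<bar>)"

definition \<phi> :: "real \<Rightarrow> real \<Rightarrow> real" where
  "\<phi> \<alpha> t = \<alpha> * \<bar>t\<bar> / (1 + \<alpha> * \<bar>t\<bar>)"

definition \<Phi> :: "real \<Rightarrow> real ^ 'p \<Rightarrow> real" where
  "\<Phi> \<alpha> x = (\<Sum>i\<in>UNIV. \<phi> \<alpha> (x $ i))"

definition k_sparse :: "nat \<Rightarrow> real ^ 'p \<Rightarrow> bool" where
  "k_sparse k x \<longleftrightarrow> card {i. x $ i \<noteq> 0} \<le> k"

definition restrict_coords :: "real ^ 'p \<Rightarrow> 'p set \<Rightarrow> real ^ 'p" where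
  "restrict_coords h S = (\<chi> i. if i \<in> S then h $ i else 0)"

end

theory Submission
  imports Defs
begin

text \<open>
  Write \<open>x = x0 + h\<close> with \<open>A h = 0\<close> and \<open>S = supp x0\<close>. The scalar penalty
  \<open>g t = \<bar>t\<bar> + \<beta> \<phi>(t)\<close> is \<open>(1 + \<beta>\<alpha>)\<close>-Lipschitz, so on \<open>S\<close> the objective drops by at most
  \<open>(1 + \<beta>\<alpha>) \<parallel>h\<^sub>S\<parallel>\<^sub>1\<close>, while off \<open>S\<close> it grows by \<open>\<parallel>h\<parallel>\<^sub>1 + \<beta> \<Phi>(h)\<close> restricted to the complement. By the
  null space inequality the net change is at least the \<open>\<beta> \<Phi>\<close> part, which is positive
  unless \<open>h\<close> vanishes off \<open>S\<close>; in that case the same inequality forces \<open>h = 0\<close>.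
\<close>

lemma phi_nonneg: "\<alpha> > 0 \<Longrightarrow> 0 \<le> \<phi> \<alpha> t"
  by (simp add: \<phi>_def add_nonneg_nonneg)

lemma phi_pos: "\<alpha> > 0 \<Longrightarrow> t \<noteq> 0 \<Longrightarrow> 0 < \<phi> \<alpha> t"
  by (simp add: \<phi>_def add_pos_pos)

text \<open>In terms of \<open>u\<close> and \<open>v\<close> the penalty values are
  \<open>1 - 1/u\<close> and \<open>1 - 1/v\<close>, so their difference is
  \<open>(u - v) / (u * v)\<close>. The denominator is at least 1, and the reverse triangle
  inequality bounds the numerator.\<close>

lemma phi_lipschitz:
  assumes "\<alpha> > 0"
  shows "\<phi> \<alpha> s - \<phi> \<alpha> t \<le> \<alpha> * \<bar>s - t\<bar>"
proof -
  define u v where "u = 1 + \<alpha> * \<bar>s\<bar>" and "v = 1 + \<alpha> * \<bar>t\<bar>"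
  have uv: "u \<ge> 1" "v \<ge> 1"
    using assms by (simp_all add: u_def v_def)
  then have uv1: "1 \<le> u * v"
    using mult_mono[of 1 u 1 v] by simp
  have "\<phi> \<alpha> s - \<phi> \<alpha> t = (u - 1) / u - (v - 1) / v"
    by (simp add: \<phi>_def u_def v_def)
  also have "\<dots> = (u - v) / (u * v)"
    using uv by (simp add: field_simps)
  also have "\<dots> \<le> \<bar>u - v\<bar> / (u * v)"
    using uv1 by (intro divide_right_mono) auto
  also have "\<dots> \<le> \<bar>u - v\<bar>"
    using uv1 mult_left_mono[of 1 "u * v" "\<bar>u - v\<bar>"] by (simp add: divide_le_eq)
  also have "\<dots> = \<alpha> * \<bar>\<bar>s\<bar> - \<bar>t\<bar>\<bar>"
    using assms by (simp add: u_def v_def abs_mult flip: right_diff_distrib)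
  also have "\<dots> \<le> \<alpha> * \<bar>s - t\<bar>"
    using assms by (intro mult_left_mono) auto
  finally show ?thesis .
qed

lemma l1_norm_restrict_coords: "l1_norm (restrict_coords h S) = (\<Sum>i\<in>S. \<bar>h $ i\<bar>)"
  unfolding l1_norm_def restrict_coords_def
  by (simp add: sum.If_cases if_distrib[of abs])

text \<open>\<open>S\<close> may be any set containing the support of \<open>x0\<close>; sparsity
  and the kernel of \<open>A\<close> enter only when the theorem supplies \<open>S\<close> and
  \<open>h\<close>.\<close>

lemma objective_less_if_null_space_property:
  fixes x0 h :: "real ^ 'p"
  assumes "\<alpha> > 0" "\<beta> > 0" "h \<noteq> 0"
    and supp: "\<And>i. i \<notin> S \<Longrightarrow> x0 $ i = 0"
    and nsp: "(1 + \<beta> * \<alpha>) * l1_norm (restrict_coords h S) \<le> l1_norm (restrict_coords h (- S))"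
  shows "l1_norm x0 + \<beta> * \<Phi> \<alpha> x0 < l1_norm (x0 + h) + \<beta> * \<Phi> \<alpha> (x0 + h)"
proof -
  define g where "g t = \<bar>t\<bar> + \<beta> * \<phi> \<alpha> t" for t
  have objective: "l1_norm x + \<beta> * \<Phi> \<alpha> x = (\<Sum>i\<in>S. g (x $ i)) + (\<Sum>i\<in>-S. g (x $ i))"
    for x :: "real ^ 'p"
  proof -
    have "l1_norm x + \<beta> * \<Phi> \<alpha> x = (\<Sum>i\<in>UNIV. g (x $ i))"
      by (simp add: l1_norm_def \<Phi>_def g_def sum.distrib sum_distrib_left)
    also have "\<dots> = (\<Sum>i\<in>S. g (x $ i)) + (\<Sum>i\<in>-S. g (x $ i))"
      by (metis Compl_eq_Diff_UNIV add.commute finite subset_UNIV sum.subset_diff)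
    finally show ?thesis .
  qed
  have nsp': "(1 + \<beta> * \<alpha>) * (\<Sum>i\<in>S. \<bar>h $ i\<bar>) \<le> (\<Sum>i\<in>-S. \<bar>h $ i\<bar>)"
    using nsp by (simp add: l1_norm_restrict_coords)
  \<comment> \<open>This index is what makes the final comparison strict.\<close>
  have "\<exists>j\<in>-S. h $ j \<noteq> 0"
  proof (rule ccontr)
    assume "\<not> ?thesis"
    then have off: "\<And>i. i \<notin> S \<Longrightarrow> h $ i = 0" by auto
    then have "(1 + \<beta> * \<alpha>) * (\<Sum>i\<in>S. \<bar>h $ i\<bar>) \<le> 0"
      using nsp' by simp
    moreover have "1 + \<beta> * \<alpha> > 0"
      using assms by (simp add: add_pos_pos)
    ultimately have "(\<Sum>i\<in>S. \<bar>h $ i\<bar>) \<le> 0"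
      by (simp add: mult_le_0_iff)
    then have "(\<Sum>i\<in>S. \<bar>h $ i\<bar>) = 0"
      by (intro antisym sum_nonneg) auto
    then have "\<And>i. i \<in> S \<Longrightarrow> h $ i = 0"
      by (simp add: sum_nonneg_eq_0_iff)
    with off have "h = 0"
      by (metis vec_eq_iff zero_index)
    with \<open>h \<noteq> 0\<close> show False by simp
  qed
  then obtain j where j: "j \<in> -S" "h $ j \<noteq> 0" by blast
  have on: "(\<Sum>i\<in>S. g (x0 $ i)) \<le> (\<Sum>i\<in>S. g ((x0 + h) $ i)) + (1 + \<beta> * \<alpha>) * (\<Sum>i\<in>S. \<bar>h $ i\<bar>)"
  proof -
    \<comment> \<open>In the Lipschitz constant, 1 comes from the absolute value and
      \<open>\<beta> * \<alpha>\<close> from the scaled penalty.\<close>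
    have "g (x0 $ i) \<le> g ((x0 + h) $ i) + (1 + \<beta> * \<alpha>) * \<bar>h $ i\<bar>" for i
    proof -
      have "\<beta> * (\<phi> \<alpha> (x0 $ i) - \<phi> \<alpha> ((x0 + h) $ i)) \<le> \<beta> * (\<alpha> * \<bar>h $ i\<bar>)"
        using phi_lipschitz[OF \<open>\<alpha> > 0\<close>, of "x0 $ i" "(x0 + h) $ i"] \<open>\<beta> > 0\<close>
        by (intro mult_left_mono) auto
      moreover have "\<bar>x0 $ i\<bar> \<le> \<bar>(x0 + h) $ i\<bar> + \<bar>h $ i\<bar>" by simp
      ultimately show ?thesis
        unfolding g_def by (simp add: algebra_simps)
    qed
    then show ?thesis
      by (simp add: sum_distrib_left sum_mono flip: sum.distrib)
  qed
  have off: "(\<Sum>i\<in>-S. g (x0 $ i)) = 0"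
    by (rule sum.neutral) (simp add: supp g_def \<phi>_def)
  \<comment> \<open>Off \<open>S\<close> the entries of \<open>x0 + h\<close> are those of
    \<open>h\<close>, so each term on the right has the surplus
    \<open>\<beta> * \<phi> \<alpha> (h $ i)\<close>, which is positive at \<open>j\<close>.\<close>
  have "(\<Sum>i\<in>-S. \<bar>h $ i\<bar>) < (\<Sum>i\<in>-S. g ((x0 + h) $ i))"
  proof (rule sum_strict_mono_ex1)
    show "\<forall>i\<in>-S. \<bar>h $ i\<bar> \<le> g ((x0 + h) $ i)"
      using assms by (auto simp: g_def phi_nonneg)
    show "\<exists>i\<in>-S. \<bar>h $ i\<bar> < g ((x0 + h) $ i)"
      using assms j by (intro bexI[of _ j]) (auto simp: g_def phi_pos)
  qed simp
  with on off nsp' show ?thesis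
    unfolding objective by linarith
qed

theorem theorem3p1:
  fixes \<alpha> \<beta> :: real and A :: "real ^ 'p ^ 'n" and k :: nat
  assumes "\<alpha> > 0" and "\<beta> > 0" and "k > 0"
    and "\<And>(h :: real ^ 'p) (S :: 'p set). A *v h = 0 \<Longrightarrow> card S \<le> k \<Longrightarrow>
      (1 + \<beta> * \<alpha>) * l1_norm (restrict_coords h S) \<le> l1_norm (restrict_coords h (- S))"
  shows "\<forall>(x0 :: real ^ 'p) (y :: real ^ 'n). k_sparse k x0 \<longrightarrow> y = A *v x0 \<longrightarrow>
    {x. is_arg_min (\<lambda>x. l1_norm x + \<beta> * \<Phi> \<alpha> x) (\<lambda>x. A *v x = y) x} = {x0}"
proof (intro allI impI)
  fix x0 :: "real ^ 'p" and y :: "real ^ 'n"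
  assume sparse: "k_sparse k x0" and y: "y = A *v x0"
  define F where "F x = l1_norm x + \<beta> * \<Phi> \<alpha> x" for x :: "real ^ 'p"
  \<comment> \<open>Strict inequality against every other feasible point yields minimality and
    uniqueness together.\<close>
  have less: "F x0 < F x" if "A *v x = y" "x \<noteq> x0" for x
  proof -
    have "A *v (x - x0) = 0"
      using that y by (simp add: matrix_vector_mult_diff_distrib)
    moreover have "card {i. x0 $ i \<noteq> 0} \<le> k"
      using sparse by (simp add: k_sparse_def)
    ultimately show ?thesis
      using objective_less_if_null_space_property[of \<alpha> \<beta> "x - x0" "{i. x0 $ i \<noteq> 0}" x0] assms that
      by (simp add: F_def)
  qed
  have "{x. is_arg_min F (\<lambda>x. A *v x = y) x} = {x0}"
    unfolding is_arg_min_def using less y by (auto dest: less_asym)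
  then show "{x. is_arg_min (\<lambda>x. l1_norm x + \<beta> * \<Phi> \<alpha> x) (\<lambda>x. A *v x = y) x} = {x0}"
    unfolding F_def .
qed

end
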